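(* Let $g\in L^2(\mathbb{R})$ and assume that $g$ is ultimately positive. Let $\Lambda=\{(\alpha_k,\beta_k)\}_{k=0}^N\subseteq\mathbb{R}^2$ be such that $\{\beta_0,\dots,\beta_N\}$ is linearly independent over $\mathbb{Q}$ (the $\beta_k$ being distinct). Then the finite Gabor system $\mathcal{G}(g,\Lambda)=\{e^{2\pi i\beta_kx}g(x-\alpha_k)\}_{k=0}^N$ is linearly independent in $L^2(\mathbb{R})$.
   Context: "Ultimately positive" means that there is $x_0\in\mathbb{R}$ such that $g(x)$ is real and $g(x)>0$ for all $x>x_0$. Linear independence of $\mathcal{G}(g,\Lambda)$ means: if $c_0,\dots,c_N\in\mathbb{C}$ and $\sum_{k=0}^N c_k e^{2\pi i\beta_kx}g(x-\alpha_k)=0$ for almost every $x\in\mathbb{R}$, then all $c_k=0$. *)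

theory Defs
  imports "HOL-Analysis.Analysis"
begin

text \<open>
  Elements of \<open>L\<^sup>2(\<real>)\<close> are represented by functions defined everywhere; identification up to null
  sets enters through \<open>AE\<close> in the definition of linear independence.
\<close>

definition L2 :: "(real \<Rightarrow> complex) set" where
  "L2 = {g. g \<in> borel_measurable lebesgue \<and> integrable lebesgue (\<lambda>x. (norm (g x))\<^sup>2)}"

definition ultimately_positive :: "(real \<Rightarrow> complex) \<Rightarrow> bool" where
  "ultimately_positive g \<longleftrightarrow> (\<exists>x0::real. \<forall>x>x0. g x \<in> \<real> \<and> Re (g x) > 0)"

interpretation rat_real: vector_space "\<lambda>(q::rat) (x::real). of_rat q * x"
  by unfold_locales (simp_all add: algebra_simps of_rat_add of_rat_mult)

definition gabor_atom :: "(real \<Rightarrow> complex) \<Rightarrow> real \<Rightarrow> real \<Rightarrow> real \<Rightarrow> complex" where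
  "gabor_atom g a b x = exp (2 * of_real pi * \<i> * of_real b * of_real x) * g (x - a)"

text \<open>
  Linear independence of the system as a family indexed by \<open>0, \<dots>, N\<close>, so repeated elements
  count as dependent.
\<close>

definition gabor_independent ::
  "(real \<Rightarrow> complex) \<Rightarrow> nat \<Rightarrow> (nat \<Rightarrow> real) \<Rightarrow> (nat \<Rightarrow> real) \<Rightarrow> bool" where
  "gabor_independent g N \<alpha> \<beta> \<longleftrightarrow>
     (\<forall>c :: nat \<Rightarrow> complex.
        (AE x in lebesgue. (\<Sum>k\<le>N. c k * gabor_atom g (\<alpha> k) (\<beta> k) x) = 0)
        \<longrightarrow> (\<forall>k\<le>N. c k = 0))"

end

theory Submission
  imports Defs
begin

text \<open>
  By Kronecker's theorem all the phases \<open>\<beta>\<^sub>k x\<close> can be steered simultaneously, at arbitrarily large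
  \<open>x\<close>, so that every nonzero \<open>c\<^sub>k exp(2\<pi>i\<beta>\<^sub>k x)\<close> has positive real part. This happens on a nonempty open
  set of \<open>x\<close>, which therefore meets every set of full measure; there the real part of the
  combination is a sum of nonnegative terms, one of which is positive.
\<close>

text \<open>Kronecker's theorem asks for independence over the integers, and an integer relation is
  in particular a rational one.\<close>

lemma rat_independent_imp_int_independent:
  assumes "rat_real.independent B"
  shows "module.independent (\<lambda>r. (*) (real_of_int r)) B"
proof -
  interpret int_real: Modules.module "\<lambda>r. (*) (real_of_int r)"
    by unfold_locales (simp_all add: algebra_simps)
  show ?thesis
    unfolding int_real.independent_explicit_module
  proof (intro allI impI)
    fix t v and u :: "real \<Rightarrow> int"
    assume t: "finite t" "t \<subseteq> B" and sum: "(\<Sum>v\<in>t. real_of_int (u v) * v) = 0" and "v \<in> t"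
    have "(\<Sum>v\<in>t. of_rat (of_int (u v)) * v) = 0"
      using sum by simp
    then have "(of_int (u v) :: rat) = 0"
      using rat_real.independentD[OF assms t, of "\<lambda>v. of_int (u v)" v] \<open>v \<in> t\<close> by simp
    then show "u v = 0"
      by simp
  qed
qed

text \<open>Kronecker's theorem yields some \<open>s\<close> with error below
  \<open>\<epsilon> / 2\<close>, possibly far to the left of \<open>X\<close>. Dirichlet's
  simultaneous approximation yields a large shift that is almost a common period and costs less than
  another \<open>\<epsilon> / 2\<close>.\<close>

lemma Kronecker_approx_unbounded:
  fixes \<alpha> \<theta> :: "nat \<Rightarrow> real" and n :: nat and X \<epsilon> :: real
  assumes "module.independent (\<lambda>r. (*) (real_of_int r)) (\<theta> ` {..<n})"
    and "inj_on \<theta> {..<n}" and "\<epsilon> > 0"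
  obtains t h where "t > X" "\<And>i. i < n \<Longrightarrow> \<bar>t * \<theta> i - of_int (h i) - \<alpha> i\<bar> < \<epsilon>"
proof -
  obtain s h where sh: "\<And>i. i < n \<Longrightarrow> \<bar>s * \<theta> i - of_int (h i) - \<alpha> i\<bar> < \<epsilon> / 2"
    using Kronecker_thm_1[OF assms(1,2), of "\<epsilon> / 2" \<alpha>] \<open>\<epsilon> > 0\<close> by auto
  obtain K :: nat where K: "K > 0" "1 / K < \<epsilon> / 2"
    using \<open>\<epsilon> > 0\<close> by (metis half_gt_zero gr_zeroI inverse_eq_divide real_arch_inverse)
  \<comment> \<open>Of \<open>q\<close> only positivity is known, so the size of the shift must come
    from \<open>M\<close>: already one step of length \<open>M\<close> leads from \<open>s\<close>
    past \<open>X\<close>. Hence Dirichlet is applied to \<open>M * \<theta> i\<close>.\<close>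
  define M where "M = \<bar>X - s\<bar> + 1"
  obtain q p where q: "0 < q"
    and p: "\<And>i. i < n \<Longrightarrow> \<bar>of_int q * (M * \<theta> i) - of_int (p i)\<bar> < 1 / K"
    using Dirichlet_approx_simult[OF K(1), of n "\<lambda>i. M * \<theta> i"] by metis
  show thesis
  proof
    have "1 * M \<le> of_int q * M"
      using q by (intro mult_right_mono) (auto simp: M_def)
    then show "s + of_int q * M > X"
      by (simp add: M_def)
    show "\<bar>(s + of_int q * M) * \<theta> i - of_int (h i + p i) - \<alpha> i\<bar> < \<epsilon>" if "i < n" for i
    proof -
      have "(s + of_int q * M) * \<theta> i - of_int (h i + p i) - \<alpha> i
          = (s * \<theta> i - of_int (h i) - \<alpha> i) + (of_int q * (M * \<theta> i) - of_int (p i))"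
        by (simp add: algebra_simps)
      then show ?thesis
        using sh[OF that] p[OF that] K(2) by linarith
    qed
  qed
qed

text \<open>Modulo full turns, the exponential cancels the argument of \<open>c\<close> up to less
  than a quarter turn, so the product lies in the open right half-plane.\<close>

lemma Re_mult_exp_pos:
  fixes c :: complex and y :: real and m :: int
  assumes "c \<noteq> 0" and "\<bar>y - of_int m - (- Arg c / (2 * pi))\<bar> < 1 / 4"
  shows "Re (c * exp (2 * of_real pi * \<i> * of_real y)) > 0"
proof -
  define d where "d = y - of_int m + Arg c / (2 * pi)"
  have d: "\<bar>d\<bar> < 1 / 4"
    using assms(2) by (simp add: d_def)
  have phase: "Arg c + 2 * pi * y = 2 * pi * d + 2 * pi * of_int m"
    by (simp add: d_def field_simps)
  have "c = of_real (norm c) * cis (Arg c)"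
    using rcis_cmod_Arg[of c] by (simp add: rcis_def)
  moreover have "exp (2 * of_real pi * \<i> * of_real y) = cis (2 * pi * y)"
    by (simp add: cis_conv_exp mult_ac)
  ultimately have "c * exp (2 * of_real pi * \<i> * of_real y)
      = of_real (norm c) * cis (Arg c + 2 * pi * y)"
    by (metis cis_mult mult.assoc)
  then have "Re (c * exp (2 * of_real pi * \<i> * of_real y)) = norm c * cos (2 * pi * d)"
    by (simp add: phase cos_add)
  moreover have "cos (2 * pi * d) > 0"
  proof (rule cos_gt_zero_pi)
    have "\<bar>2 * pi * d\<bar> = 2 * pi * \<bar>d\<bar>"
      by (simp add: abs_mult)
    also have "\<dots> < 2 * pi * (1 / 4)"
      using d by (intro mult_strict_left_mono) auto
    finally have "\<bar>2 * pi * d\<bar> < pi / 2"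
      by simp
    then show "- (pi / 2) < 2 * pi * d" "2 * pi * d < pi / 2"
      by linarith+
  qed
  ultimately show ?thesis
    using \<open>c \<noteq> 0\<close> by simp
qed

lemma AE_lebesgue_meets_open:
  fixes S :: "'a::euclidean_space set"
  assumes "AE x in lebesgue. P x" "open S" "S \<noteq> {}"
  obtains x where "x \<in> S" "P x"
proof -
  have "\<not> (\<forall>x\<in>S. \<not> P x)"
  proof
    assume "\<forall>x\<in>S. \<not> P x"
    with assms(1) have "AE x\<in>S in lebesgue. x \<in> {}"
      by (auto elim: eventually_mono)
    with assms(2,3) show False
      \<comment> \<open>A closed set containing almost every point of an open set contains all of
        it; here the closed set is empty.\<close>
      using mem_closed_if_AE_lebesgue_open[of S "{}"] by auto
  qed
  then show thesis
    using that by auto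
qed

theorem theorem5p2:
  fixes g :: "real \<Rightarrow> complex" and N :: nat and \<alpha> \<beta> :: "nat \<Rightarrow> real"
  assumes "g \<in> L2"
    and "ultimately_positive g"
    and "inj_on \<beta> {..N}"
    and "rat_real.independent (\<beta> ` {..N})"
  shows "gabor_independent g N \<alpha> \<beta>"
  unfolding gabor_independent_def
proof (intro allI impI, rule ccontr)
  fix c :: "nat \<Rightarrow> complex" and k
  assume ae: "AE x in lebesgue. (\<Sum>k\<le>N. c k * gabor_atom g (\<alpha> k) (\<beta> k) x) = 0"
    and k: "k \<le> N" "c k \<noteq> 0"
  obtain x0 where x0: "\<And>x. x > x0 \<Longrightarrow> g x \<in> \<real> \<and> Re (g x) > 0"
    using assms(2) unfolding ultimately_positive_def by blast
  \<comment> \<open>Beyond \<open>X\<close> all translates of \<open>g\<close> are positive at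
    once.\<close>
  define X where "X = x0 + (\<Sum>k\<le>N. \<bar>\<alpha> k\<bar>)"
  define w where "w k x = c k * exp (2 * of_real pi * \<i> * of_real (\<beta> k * x))" for k x
  \<comment> \<open>Indices with \<open>c k = 0\<close> are left out: there \<open>w k\<close>
    vanishes and the set would be empty.\<close>
  define S where "S = {X<..} \<inter> (\<Inter>k\<in>{k. k \<le> N \<and> c k \<noteq> 0}. {x. Re (w k x) > 0})"
  have "open S"
    unfolding S_def w_def
    by (intro open_Int open_INT ballI open_Collect_less continuous_intros) auto
  moreover have "S \<noteq> {}"
  proof -
    obtain t h where th: "t > X"
      "\<And>i. i < Suc N \<Longrightarrow> \<bar>t * \<beta> i - of_int (h i) - (- Arg (c i) / (2 * pi))\<bar> < 1 / 4"
      using Kronecker_approx_unbounded[of \<beta> "Suc N" "1/4" X "\<lambda>i. - Arg (c i) / (2 * pi)"]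
        rat_independent_imp_int_independent[OF assms(4)] assms(3)
      by (auto simp: lessThan_Suc_atMost)
    have "Re (w i t) > 0" if "i \<le> N" "c i \<noteq> 0" for i
      using Re_mult_exp_pos[OF that(2) th(2)] that by (simp add: w_def mult.commute)
    with th(1) have "t \<in> S"
      by (auto simp: S_def)
    then show ?thesis
      by blast
  qed
  ultimately obtain x where "x \<in> S" and
    zero: "(\<Sum>k\<le>N. c k * gabor_atom g (\<alpha> k) (\<beta> k) x) = 0"
    using AE_lebesgue_meets_open[OF ae] by blast
  then have "x > X" and w: "\<And>i. i \<le> N \<Longrightarrow> c i \<noteq> 0 \<Longrightarrow> Re (w i x) > 0"
    by (auto simp: S_def)
  have g_pos: "g (x - \<alpha> i) \<in> \<real> \<and> Re (g (x - \<alpha> i)) > 0" if "i \<le> N" for i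
  proof (rule x0)
    have "\<bar>\<alpha> i\<bar> \<le> (\<Sum>k\<le>N. \<bar>\<alpha> k\<bar>)"
      using that by (intro member_le_sum) auto
    then show "x - \<alpha> i > x0"
      using \<open>x > X\<close> by (simp add: X_def)
  qed
  \<comment> \<open>The real part splits as a product because the value of \<open>g\<close> is
    real.\<close>
  have Re_term: "Re (c i * gabor_atom g (\<alpha> i) (\<beta> i) x) = Re (w i x) * Re (g (x - \<alpha> i))"
    if "i \<le> N" for i
    using g_pos[OF that] by (auto simp: gabor_atom_def w_def complex_is_Real_iff algebra_simps)
  have pos: "Re (c i * gabor_atom g (\<alpha> i) (\<beta> i) x) > 0" if "i \<le> N" "c i \<noteq> 0" for i
    unfolding Re_term[OF that(1)] using w[OF that] g_pos[OF that(1)] by simp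
  have "(\<Sum>i\<le>N. Re (c i * gabor_atom g (\<alpha> i) (\<beta> i) x)) > 0"
  proof (rule sum_pos2[of _ k])
    show "Re (c i * gabor_atom g (\<alpha> i) (\<beta> i) x) \<ge> 0" if "i \<in> {..N}" for i
      using pos[of i] that by (cases "c i = 0") auto
  qed (use k pos in auto)
  moreover have "(\<Sum>i\<le>N. Re (c i * gabor_atom g (\<alpha> i) (\<beta> i) x)) = 0"
    using arg_cong[OF zero, of Re] by (simp only: Re_sum zero_complex.sel)
  ultimately show False
    by simp
qed

end
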